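(* Let $\mathcal{H}$ be a real Hilbert space, $\alpha>0$, and let $f_1,\dots,f_m:\mathcal{H}\to\mathbb{R}$ be convex and differentiable with gradients $\nabla f_i$ that are Lipschitz continuous on bounded sets. Let $x_0,v_0\in\mathcal{H}$ be arbitrary and let $x:[0,+\infty)\to\mathcal{H}$ be a solution of the Cauchy problem $$\ddot{x}(t)+\alpha\dot{x}(t)+\operatorname{proj}_{C(x(t))}(-\ddot{x}(t))=0,\qquad x(0)=x_0,\ \dot{x}(0)=v_0,$$ where $C(x)=\operatorname{co}(\{\nabla f_i(x): i=1,\dots,m\})$. If $x$ is bounded, then $x(t)$ converges weakly, as $t\to+\infty$, to a Pareto critical point of the multiobjective problem $\min_{x\in\mathcal{H}}(f_1(x),\dots,f_m(x))$.
   Context: $\operatorname{co}$ denotes the convex hull and $\operatorname{proj}_K$ the metric projection onto a nonempty closed convex set $K$. A solution of the Cauchy problem on $[0,+\infty)$ is a twice continuously differentiable function satisfying the equation for all $t$ and the initial conditions. A point $x^*\in\mathcal{H}$ is Pareto critical if there is $\theta\in\mathbb{R}^m$ with $\theta\ge 0$, $\sum_i\theta_i=1$ and $\sum_{i=1}^m\theta_i\nabla f_i(x^* )=0$, i.e. $0\in C(x^* )$. *)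

theory Defs
  imports "HOL-Analysis.Analysis"
begin

text \<open>A real Hilbert space is a type of sort \<open>{real_inner, complete_space}\<close>. The objective
  functions are \<open>f 1, \<dots>, f m\<close>; the values of \<open>f\<close> at other indices play no role.\<close>

text \<open>The Riesz representative of the Frechet derivative. On a Hilbert space it exists wherever
  \<open>f\<close> is differentiable.\<close>

definition gradient :: "('a::real_inner \<Rightarrow> real) \<Rightarrow> 'a \<Rightarrow> 'a" where
  "gradient f x = (THE D. GDERIV f x :> D)"

lemma gradient_eqI:
  assumes "GDERIV f x :> D"
  shows "gradient f x = D"
  unfolding gradient_def
proof (rule the_equality)
  fix E assume "GDERIV f x :> E"
  with assms have "(\<lambda>h. inner h E) = (\<lambda>h. inner h D)"
    unfolding gderiv_def by (rule has_derivative_unique[rotated])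
  then have "inner (E - D) E = inner (E - D) D" by metis
  then have "inner (E - D) (E - D) = 0" by (simp add: inner_diff_right)
  then show "E = D" by simp
qed (fact assms)

text \<open>The library's \<open>closest_point\<close> requires \<open>heine_borel\<close>, which excludes infinite-dimensional
  spaces. The nearest point exists and is unique if \<open>K\<close> is nonempty, closed and convex.\<close>

definition proj :: "'a::real_inner set \<Rightarrow> 'a \<Rightarrow> 'a" where
  "proj K x = (THE y. y \<in> K \<and> (\<forall>z\<in>K. dist x y \<le> dist x z))"

definition gradient_hull :: "nat \<Rightarrow> (nat \<Rightarrow> 'a::real_inner \<Rightarrow> real) \<Rightarrow> 'a \<Rightarrow> 'a set" where
  "gradient_hull m f x = convex hull {gradient (f i) x | i. i \<in> {1..m}}"

text \<open>Derivatives are taken within \<open>[0, \<infinity>)\<close>, hence one-sided at \<open>0\<close>; the values of \<open>x\<close> at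
  negative times are irrelevant.\<close>

definition cauchy_solution ::
  "nat \<Rightarrow> (nat \<Rightarrow> 'a::real_inner \<Rightarrow> real) \<Rightarrow> real \<Rightarrow> 'a \<Rightarrow> 'a \<Rightarrow> (real \<Rightarrow> 'a) \<Rightarrow> bool" where
  "cauchy_solution m f \<alpha> x0 v0 x \<longleftrightarrow>
    (\<exists>x' x''.
      (\<forall>t\<ge>0. (x has_vector_derivative x' t) (at t within {0..})) \<and>
      (\<forall>t\<ge>0. (x' has_vector_derivative x'' t) (at t within {0..})) \<and>
      continuous_on {0..} x'' \<and>
      (\<forall>t\<ge>0. x'' t + \<alpha> *\<^sub>R x' t + proj (gradient_hull m f (x t)) (- x'' t) = 0) \<and>
      x 0 = x0 \<and> x' 0 = v0)"

definition pareto_critical :: "nat \<Rightarrow> (nat \<Rightarrow> 'a::real_inner \<Rightarrow> real) \<Rightarrow> 'a \<Rightarrow> bool" where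
  "pareto_critical m f x \<longleftrightarrow>
    (\<exists>\<theta>::nat \<Rightarrow> real. (\<forall>i\<in>{1..m}. 0 \<le> \<theta> i) \<and> (\<Sum>i=1..m. \<theta> i) = 1 \<and>
      (\<Sum>i=1..m. \<theta> i *\<^sub>R gradient (f i) x) = 0)"

definition weakly_converges :: "('b \<Rightarrow> 'a::real_normed_vector) \<Rightarrow> 'a \<Rightarrow> 'b filter \<Rightarrow> bool" where
  "weakly_converges x l F \<longleftrightarrow>
    (\<forall>\<phi>::'a \<Rightarrow> real. bounded_linear \<phi> \<longrightarrow> ((\<lambda>t. \<phi> (x t)) \<longlongrightarrow> \<phi> l) F)"

end

theory Submission
  imports Defs
begin

text \<open>
  Write \<open>p t\<close> for the element of \<open>C (x t)\<close> that the equation selects, so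
  \<open>x'' + \<alpha> x' = - p\<close>. Since \<open>p\<close> is the projection of \<open>- x''\<close> and \<open>- x'' - p = \<alpha> x'\<close>, the
  variational inequality of the projection reads \<open>\<langle>x', \<nabla>f i (x)\<rangle> \<le> \<langle>x', p\<rangle>\<close> for every \<open>i\<close>. This
  single inequality makes all the energies \<open>W i = f i (x) + |x'|\<^sup>2 / 2\<close> decrease at once, at
  rate at least \<open>\<alpha> |x'|\<^sup>2\<close> (\<open>W'_le\<close>). A bounded trajectory keeps the energies bounded below and the
  acceleration bounded, so they converge, the velocity vanishes (\<open>velocity_tendsto_0\<close>), and
  \<open>f i (x t)\<close> tends to a limit \<open>F i\<close> that stays below \<open>W i\<close>.

  For a fixed point \<open>z\<close>, convexity turns the equation into a differential inequality for
  \<open>|x - z|\<^sup>2\<close>: if \<open>f i z + \<delta> \<le> F i\<close> for all \<open>i\<close>, then adding a multiple of an energy to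
  \<open>\<langle>x - z, x'\<rangle> + \<alpha>/2 |x - z|\<^sup>2\<close> gives a function that decreases at rate at least \<open>\<delta>\<close> (\<open>G'_le\<close>).
  With \<open>\<delta> > 0\<close> this contradicts boundedness, so no point lies strictly below all the limits
  \<open>F i\<close> (\<open>not_uniformly_below_limits\<close>). With \<open>\<delta> = 0\<close> it shows that \<open>|x - z|\<close> converges for each
  \<open>z\<close> in the set \<open>{z. \<forall>i. f i z \<le> F i}\<close> (\<open>distance_tendsto\<close>).

  The second fact is the hypothesis of Opial's argument. Weak cluster points of \<open>x\<close> exist, lie in
  that set because sublevel sets of the \<open>f i\<close> are closed and convex, and coincide because the
  distances to any two of them converge (\<open>cluster_unique\<close>); hence \<open>x\<close> converges weakly to some \<open>w\<close>.
  The first fact makes \<open>w\<close> Pareto critical: if \<open>0\<close> were not in \<open>C w\<close>, the negative of the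
  minimal-norm element of \<open>C w\<close> would be a common descent direction at \<open>w\<close>, and a small step along
  it would lead strictly below all \<open>F i\<close>.

  Weak compactness enters through the intersection property of nested bounded closed
  convex sets (\<open>decreasing_closed_convex_nest\<close>), which follows from the parallelogram law; the same
  property yields the Riesz theorem, hence the existence of gradients.
\<close>

section \<open>Convexity and gradients in Hilbert spaces\<close>

lemma infdist_lessE:
  assumes "A \<noteq> {}" "infdist x A < r"
  obtains a where "a \<in> A" "dist x a < r"
proof -
  have "\<exists>a\<in>A. dist x a < r"
  proof (rule ccontr)
    assume "\<not> ?thesis"
    then have "r \<le> (INF a\<in>A. dist x a)"
      using assms(1) by (intro cINF_greatest) (auto simp: not_less)
    then show False using assms by (simp add: infdist_notempty)
  qed
  then show thesis using that by blast
qed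

text \<open>This replaces weak compactness of balls. The distances from \<open>0\<close> to the sets increase to
  some \<open>D\<close>. Two points of \<open>C n\<close> with norm close to \<open>D\<close> have their midpoint in \<open>C n\<close>, hence also of
  norm almost \<open>D\<close>, and the parallelogram law forces them to be close to each other. Cutting the sets
  down to such points makes their diameters tend to \<open>0\<close>, so completeness applies.\<close>

lemma decreasing_closed_convex_nest:
  fixes C :: "nat \<Rightarrow> 'a::{real_inner, complete_space} set"
  assumes closed: "\<And>n. closed (C n)" and convex: "\<And>n. convex (C n)"
    and nonempty: "\<And>n. C n \<noteq> {}" and decreasing: "\<And>m n. m \<le> n \<Longrightarrow> C n \<subseteq> C m"
    and bounded: "bounded (C 0)"
  obtains a where "\<And>n. a \<in> C n"
proof -
  define d where "d n = infdist 0 (C n)" for n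
  have d_le: "d n \<le> norm y" if "y \<in> C n" for n y
    using infdist_le[OF that, of 0] by (simp add: d_def)
  have d_ge0: "0 \<le> d n" for n by (simp add: d_def infdist_nonneg)
  obtain B where B: "\<And>y. y \<in> C 0 \<Longrightarrow> norm y \<le> B"
    using bounded by (auto simp: bounded_iff)
  have "d n \<le> B" for n
    by (metis B d_le decreasing nonempty ex_in_conv le0 order_trans subsetD)
  then have bdd: "bdd_above (range d)" by (intro bdd_aboveI[of _ B]) auto
  define D where "D = (SUP n. d n)"
  have d_D: "d n \<le> D" for n unfolding D_def by (intro cSUP_upper bdd) simp
  have D0: "0 \<le> D" using d_ge0 d_D order_trans by blast
  define S where "S n = C n \<inter> {y. (norm y)\<^sup>2 \<le> D\<^sup>2 + inverse (Suc n)}" for n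
  show thesis
  proof (rule decreasing_closed_nest[of S])
    show "closed (S n)" for n
      unfolding S_def by (intro closed_Int closed closed_Collect_le continuous_intros)
    show "S n \<noteq> {}" for n
    proof -
      have "D < sqrt (D\<^sup>2 + inverse (Suc n))"
        by (rule real_less_rsqrt) simp
      then have "infdist 0 (C n) < sqrt (D\<^sup>2 + inverse (Suc n))"
        using d_D[of n] by (simp add: d_def)
      then obtain y where y: "y \<in> C n" "dist 0 y < sqrt (D\<^sup>2 + inverse (Suc n))"
        using infdist_lessE[OF nonempty] by blast
      then have "(norm y)\<^sup>2 \<le> (sqrt (D\<^sup>2 + inverse (Suc n)))\<^sup>2"
        by (intro power_mono) auto
      then show ?thesis using y by (auto simp: S_def)
    qed
    show "S n \<subseteq> S m" if "m \<le> n" for m n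
    proof -
      have "inverse (real (Suc n)) \<le> inverse (real (Suc m))"
        using that by (intro le_imp_inverse_le) auto
      then have "{y :: 'a. (norm y)\<^sup>2 \<le> D\<^sup>2 + inverse (Suc n)}
          \<subseteq> {y. (norm y)\<^sup>2 \<le> D\<^sup>2 + inverse (Suc m)}"
        by (intro Collect_mono impI) linarith
      then show ?thesis using decreasing[OF that] unfolding S_def by (intro Int_mono)
    qed
    show "\<exists>n. \<forall>y\<in>S n. \<forall>z\<in>S n. dist y z < e" if "0 < e" for e
    proof -
      \<comment> \<open>The parallelogram law below bounds the squared distance by \<open>4 (D\<^sup>2 - (d k)\<^sup>2) + 4 / (n + 1)\<close>;
        each of the two terms is allotted half of \<open>e\<^sup>2\<close>. The distance of \<open>d k\<close> from \<open>D\<close> is chosen to give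
        \<open>D\<^sup>2 - (d k)\<^sup>2 < \<eta>\<close>, with \<open>+ 1\<close> for the case \<open>D = 0\<close>.\<close>
      define \<eta> where "\<eta> = e\<^sup>2 / 8"
      have \<eta>: "0 < \<eta>" using that by (simp add: \<eta>_def)
      obtain k where k: "D - \<eta> / (2 * D + 1) < d k"
      proof -
        have "D - \<eta> / (2 * D + 1) < D" using \<eta> D0 by simp
        then show thesis using that less_cSUP_iff[OF _ bdd] unfolding D_def by auto
      qed
      obtain l where l: "inverse (real (Suc l)) < \<eta>" using reals_Archimedean[OF \<eta>] by blast
      define n where "n = max k l"
      have ln: "inverse (real (Suc n)) < \<eta>"
      proof -
        have "inverse (real (Suc n)) \<le> inverse (real (Suc l))" by (simp add: n_def)
        with l show ?thesis by linarith
      qed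
      have dist: "dist y z < e" if yz: "y \<in> S n" "z \<in> S n" for y z
      proof -
        have mid: "(1/2) *\<^sub>R y + (1/2) *\<^sub>R z \<in> C n"
          using yz by (intro convexD[OF convex]) (auto simp: S_def)
        then have "(1/2) *\<^sub>R y + (1/2) *\<^sub>R z \<in> C k"
          using decreasing[of k n] by (auto simp: n_def)
        then have "d k \<le> norm ((1/2) *\<^sub>R y + (1/2) *\<^sub>R z)" by (rule d_le)
        also have "\<dots> = norm (y + z) / 2"
          by (simp add: scaleR_right_distrib[symmetric])
        finally have "2 * d k \<le> norm (y + z)" by simp
        then have "(2 * d k)\<^sup>2 \<le> (norm (y + z))\<^sup>2" by (intro power_mono) (simp_all add: d_ge0)
        moreover have "D\<^sup>2 - (d k)\<^sup>2 < \<eta>"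
        proof -
          have "D\<^sup>2 - (d k)\<^sup>2 = (D - d k) * (D + d k)" by (simp add: power2_eq_square algebra_simps)
          also have "\<dots> \<le> (D - d k) * (2 * D + 1)"
            using d_D[of k] by (intro mult_left_mono) auto
          also have "\<dots> < \<eta>"
            using k D0 by (simp add: field_simps)
          finally show ?thesis .
        qed
        moreover have "(norm (y - z))\<^sup>2 + (norm (y + z))\<^sup>2 = 2 * (norm y)\<^sup>2 + 2 * (norm z)\<^sup>2"
          by (simp add: power2_norm_eq_inner algebra_simps inner_commute)
        moreover have "(norm y)\<^sup>2 \<le> D\<^sup>2 + inverse (Suc n)" "(norm z)\<^sup>2 \<le> D\<^sup>2 + inverse (Suc n)"
          using yz by (auto simp: S_def)
        ultimately have "(norm (y - z))\<^sup>2 < 8 * \<eta>"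
          using ln by (simp add: power_mult_distrib)
        then have "norm (y - z) < e"
          using \<open>0 < e\<close> by (auto simp: \<eta>_def intro: power2_less_imp_less)
        then show ?thesis by (simp add: dist_norm)
      qed
      show ?thesis using dist by blast
    qed
  qed (use that S_def in blast)
qed

lemma minimal_norm_point_exists:
  fixes K :: "'a::{real_inner, complete_space} set"
  assumes "closed K" "convex K" "K \<noteq> {}"
  obtains a where "a \<in> K" "\<And>z. z \<in> K \<Longrightarrow> norm a \<le> norm z"
proof -
  define r where "r n = infdist 0 K + inverse (Suc n)" for n
  have nonempty: "K \<inter> cball 0 (r n) \<noteq> {}" for n
  proof -
    have "infdist 0 K < r n" by (simp add: r_def)
    then obtain y where "y \<in> K" "dist 0 y < r n"
      using infdist_lessE[OF assms(3)] by blast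
    then show ?thesis by auto
  qed
  have anti: "r n \<le> r m" if "m \<le> n" for m n
    unfolding r_def using that by simp
  obtain a where a: "\<And>n. a \<in> K \<inter> cball 0 (r n)"
  proof (rule decreasing_closed_convex_nest[of "\<lambda>n. K \<inter> cball 0 (r n)"])
    show "K \<inter> cball 0 (r n) \<subseteq> K \<inter> cball 0 (r m)" if "m \<le> n" for m n
      using anti[OF that] by auto
  qed (use assms nonempty in \<open>auto intro: convex_Int closed_Int bounded_Int\<close>)
  have "norm a \<le> infdist 0 K"
  proof (rule field_le_epsilon)
    fix e :: real assume "0 < e"
    then obtain n where "inverse (real (Suc n)) < e" using reals_Archimedean by blast
    moreover have "norm a \<le> r n" using a[of n] by simp
    ultimately show "norm a \<le> infdist 0 K + e" by (simp add: r_def)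
  qed
  moreover have "infdist 0 K \<le> norm z" if "z \<in> K" for z
    using infdist_le[OF that, of 0] by simp
  ultimately have "\<And>z. z \<in> K \<Longrightarrow> norm a \<le> norm z" using order_trans by blast
  then show thesis using that a by blast
qed

text \<open>The variational inequality of the projection of \<open>0\<close> onto \<open>K\<close>.\<close>

lemma minimal_norm_inner_ge:
  fixes K :: "'a::real_inner set"
  assumes "convex K" "closed K" "a \<in> K" "\<And>z. z \<in> K \<Longrightarrow> norm a \<le> norm z" "z \<in> K"
  shows "inner a a \<le> inner a z"
  using any_closest_point_dot[OF assms(1-3,5), of 0] assms(4) by (simp add: inner_diff_right)

text \<open>For \<open>\<phi> \<noteq> 0\<close> the representing vector is a multiple of the minimal-norm point of the hyperplane
  \<open>\<phi> = 1\<close>, because that point is orthogonal to the kernel of \<open>\<phi>\<close>.\<close>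

lemma Riesz_representation:
  fixes \<phi> :: "'a::{real_inner, complete_space} \<Rightarrow> real"
  assumes "bounded_linear \<phi>"
  obtains D where "\<And>h. \<phi> h = inner h D"
proof (cases "\<forall>h. \<phi> h = 0")
  case True
  then show ?thesis using that[of 0] by simp
next
  case False
  interpret bounded_linear \<phi> by fact
  define K where "K = {h. \<phi> h = 1}"
  obtain h where "\<phi> h \<noteq> 0" using False by blast
  then have "h /\<^sub>R \<phi> h \<in> K" by (simp add: K_def scaleR)
  then have nonempty: "K \<noteq> {}" by blast
  have closed: "closed K"
    unfolding K_def by (intro closed_Collect_eq continuous_intros linear_continuous_on assms)
  have cvx: "convex K"
    by (auto simp: K_def convex_def add scaleR)
  obtain a where a: "a \<in> K" "\<And>z. z \<in> K \<Longrightarrow> norm a \<le> norm z"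
    using minimal_norm_point_exists[OF closed cvx nonempty] by blast
  have \<phi>a: "\<phi> a = 1" using a by (simp add: K_def)
  then have "a \<noteq> 0" using zero by auto
  have kernel: "inner a v = 0" if "\<phi> v = 0" for v
  proof -
    have "a + v \<in> K" "a - v \<in> K" using that \<phi>a by (simp_all add: K_def add diff)
    then have "inner a a \<le> inner a (a + v)" "inner a a \<le> inner a (a - v)"
      using minimal_norm_inner_ge[OF cvx closed a] by blast+
    then show ?thesis by (simp add: inner_add_right inner_diff_right)
  qed
  have "\<phi> h = inner h (a /\<^sub>R inner a a)" for h
  proof -
    have "\<phi> (h - \<phi> h *\<^sub>R a) = 0" by (simp add: diff scaleR \<phi>a)
    then have "inner a (h - \<phi> h *\<^sub>R a) = 0" by (rule kernel)
    then show ?thesis using \<open>a \<noteq> 0\<close> by (simp add: inner_diff_right inner_commute field_simps)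
  qed
  then show ?thesis by (rule that)
qed

lemma gderiv_gradient:
  fixes f :: "'a::{real_inner, complete_space} \<Rightarrow> real"
  assumes "f differentiable (at y)"
  shows "GDERIV f y :> gradient f y"
proof -
  obtain f' where f': "(f has_derivative f') (at y)"
    using assms by (auto simp: differentiable_def)
  obtain D where "\<And>h. f' h = inner h D"
    using Riesz_representation[OF has_derivative_bounded_linear[OF f']] by blast
  then have "GDERIV f y :> D" using f' unfolding gderiv_def by (metis (no_types) ext)
  then show ?thesis using gradient_eqI by blast
qed

lemma gderiv_tendsto_slope:
  fixes f :: "'a::real_inner \<Rightarrow> real"
  assumes "GDERIV f y :> D"
  shows "((\<lambda>s. (f (y + s *\<^sub>R h) - f y) / s) \<longlongrightarrow> inner D h) (at_right 0)"
proof -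
  have "((\<lambda>s::real. y + s *\<^sub>R h) has_derivative (\<lambda>s. s *\<^sub>R h)) (at 0)"
    by (auto intro!: derivative_eq_intros)
  then have "((\<lambda>s. f (y + s *\<^sub>R h)) has_derivative (\<lambda>s. inner (s *\<^sub>R h) D)) (at 0)"
    by (rule has_derivative_compose) (use assms in \<open>simp add: gderiv_def\<close>)
  then have "((\<lambda>s. f (y + s *\<^sub>R h)) has_real_derivative inner D h) (at 0)"
    unfolding has_field_derivative_def
    by (rule has_derivative_eq_rhs) (simp add: fun_eq_iff inner_commute)
  then have "((\<lambda>s. (f (y + s *\<^sub>R h) - f y) / s) \<longlongrightarrow> inner D h) (at 0)"
    by (simp add: has_field_derivative_iff)
  then show ?thesis by (rule filterlim_mono) (auto simp: at_le)
qed

text \<open>By convexity each difference quotient along the segment from \<open>y\<close> to \<open>z\<close> is at most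
  \<open>f z - f y\<close>; the bound passes to the limit.\<close>

lemma convex_on_ge_tangent:
  fixes f :: "'a::real_inner \<Rightarrow> real"
  assumes "convex_on UNIV f" "GDERIV f y :> D"
  shows "f y + inner D (z - y) \<le> f z"
proof -
  have "eventually (\<lambda>s. (f (y + s *\<^sub>R (z - y)) - f y) / s \<le> f z - f y) (at_right 0)"
    unfolding eventually_at_right_field
  proof (intro exI[of _ 1] conjI allI impI)
    fix s :: real assume s: "0 < s" "s < 1"
    have "f ((1 - s) *\<^sub>R y + s *\<^sub>R z) \<le> (1 - s) * f y + s * f z"
      using s by (intro convex_onD[OF assms(1)]) auto
    moreover have "(1 - s) *\<^sub>R y + s *\<^sub>R z = y + s *\<^sub>R (z - y)" by (simp add: algebra_simps)
    ultimately show "(f (y + s *\<^sub>R (z - y)) - f y) / s \<le> f z - f y"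
      using s by (simp add: field_simps)
  qed simp
  from tendsto_upperbound[OF gderiv_tendsto_slope[OF assms(2)] this]
  show ?thesis by simp
qed

text \<open>The hull of a finite set is compact, so a nearest point exists in a space of any
  dimension and the definite description in \<open>proj\<close> is meaningful.\<close>

lemma proj_finite_hull:
  fixes S :: "'a::real_inner set"
  assumes "finite S" "S \<noteq> {}"
  shows "proj (convex hull S) u \<in> convex hull S"
    and "z \<in> convex hull S \<Longrightarrow> inner (u - proj (convex hull S) u) (z - proj (convex hull S) u) \<le> 0"
proof -
  let ?K = "convex hull S"
  have K: "compact ?K" "?K \<noteq> {}"
    using assms finite_imp_compact_convex_hull by auto
  then have closed: "closed ?K" by (simp add: compact_imp_closed)
  have "continuous_on ?K (dist u)" by (intro continuous_intros)
  then obtain a where a: "a \<in> ?K" "\<forall>z\<in>?K. dist u a \<le> dist u z"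
    using continuous_attains_inf[OF K] by blast
  then have "proj ?K u = a"
    unfolding proj_def using any_closest_point_unique[OF convex_convex_hull closed]
    by (intro the_equality) blast+
  with a show "proj ?K u \<in> ?K"
    and "z \<in> ?K \<Longrightarrow> inner (u - proj ?K u) (z - proj ?K u) \<le> 0"
    using any_closest_point_dot[OF convex_convex_hull closed] by auto
qed

text \<open>The weights are attached to the indices and not to the points, since \<open>g\<close> may take the
  same value at several indices.\<close>

lemma convex_hull_image_weights:
  fixes g :: "nat \<Rightarrow> 'a::real_vector"
  assumes "finite I" "q \<in> convex hull (g ` I)"
  obtains \<theta> :: "nat \<Rightarrow> real"
  where "\<And>i. i \<in> I \<Longrightarrow> 0 \<le> \<theta> i" "sum \<theta> I = 1" "(\<Sum>i\<in>I. \<theta> i *\<^sub>R g i) = q"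
proof -
  let ?S = "{(\<Sum>i\<in>I. \<theta> i *\<^sub>R g i) | \<theta>. (\<forall>i\<in>I. 0 \<le> \<theta> i) \<and> sum \<theta> I = (1::real)}"
  have "g ` I \<subseteq> ?S"
  proof clarify
    fix j assume j: "j \<in> I"
    have "(\<Sum>i\<in>I. of_bool (i = j) *\<^sub>R g i) = (\<Sum>i\<in>I. if i = j then g i else 0)"
      by (intro sum.cong) auto
    then show "\<exists>\<theta>. g j = (\<Sum>i\<in>I. \<theta> i *\<^sub>R g i) \<and> (\<forall>i\<in>I. 0 \<le> \<theta> i) \<and> sum \<theta> I = (1::real)"
      using j assms(1) by (intro exI[of _ "\<lambda>i. of_bool (i = j)"]) (auto simp: of_bool_def)
  qed
  moreover have "convex ?S"
  proof (rule convexI, clarify)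
    fix u v :: real and \<theta> \<eta> :: "nat \<Rightarrow> real"
    assume uv: "0 \<le> u" "0 \<le> v" "u + v = 1"
      and "\<forall>i\<in>I. 0 \<le> \<theta> i" "\<forall>i\<in>I. 0 \<le> \<eta> i" "sum \<theta> I = 1" "sum \<eta> I = 1"
    then show "\<exists>\<xi>. u *\<^sub>R (\<Sum>i\<in>I. \<theta> i *\<^sub>R g i) + v *\<^sub>R (\<Sum>i\<in>I. \<eta> i *\<^sub>R g i) = (\<Sum>i\<in>I. \<xi> i *\<^sub>R g i)
        \<and> (\<forall>i\<in>I. 0 \<le> \<xi> i) \<and> sum \<xi> I = 1"
      by (intro exI[of _ "\<lambda>i. u * \<theta> i + v * \<eta> i"])
        (simp add: scaleR_sum_right scaleR_add_left sum.distrib flip: sum_distrib_left)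
  qed
  ultimately have "convex hull (g ` I) \<subseteq> ?S" by (rule hull_minimal)
  then show thesis using assms(2) that by blast
qed

lemma lipschitz_on_bounded_image:
  assumes "L-lipschitz_on S h" "bounded S"
  shows "bounded (h ` S)"
proof -
  obtain B where "\<And>y z. y \<in> S \<Longrightarrow> z \<in> S \<Longrightarrow> dist y z \<le> B"
    using assms(2) unfolding bounded_two_points by blast
  then have "dist (h y) (h z) \<le> L * B" if "y \<in> S" "z \<in> S" for y z
    using lipschitz_onD[OF assms(1) that] lipschitz_on_nonneg[OF assms(1)] that
    by (meson mult_left_mono order_trans)
  then show ?thesis unfolding bounded_two_points by blast
qed

section \<open>Scalar functions with a one-sided derivative bound\<close>

lemma has_real_derivative_inner:
  fixes u v :: "real \<Rightarrow> 'a::real_inner"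
  assumes "(u has_vector_derivative u') (at t within S)" "(v has_vector_derivative v') (at t within S)"
  shows "((\<lambda>t. inner (u t) (v t)) has_real_derivative inner (u t) v' + inner u' (v t)) (at t within S)"
  using has_derivative_inner[OF assms[unfolded has_vector_derivative_def]]
  unfolding has_field_derivative_def
  by (rule has_derivative_eq_rhs) (auto simp: algebra_simps)

lemma deriv_nonpos_imp_antimono:
  fixes \<phi> :: "real \<Rightarrow> real"
  assumes deriv: "\<And>t. 0 \<le> t \<Longrightarrow> (\<phi> has_real_derivative \<phi>' t) (at t within {0..})"
    and nonpos: "\<And>t. T \<le> t \<Longrightarrow> \<phi>' t \<le> 0" and st: "0 \<le> T" "T \<le> s" "s \<le> t"
  shows "\<phi> t \<le> \<phi> s"
proof (rule DERIV_nonpos_imp_decreasing_open[OF st(3)])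
  show "continuous_on {s..t} \<phi>"
    using DERIV_continuous_on[of "{0..}" \<phi>] deriv st
    by (intro continuous_on_subset[of "{0..}" \<phi> "{s..t}"]) auto
  fix u assume u: "s < u" "u < t"
  have "at u within {0..} = at u" using u st by (intro at_within_interior) auto
  then show "\<exists>y. (\<phi> has_real_derivative y) (at u) \<and> y \<le> 0"
    using deriv[of u] nonpos[of u] u st by auto
qed

lemma deriv_nonpos_bounded_below_tendsto:
  fixes \<phi> :: "real \<Rightarrow> real"
  assumes deriv: "\<And>t. 0 \<le> t \<Longrightarrow> (\<phi> has_real_derivative \<phi>' t) (at t within {0..})"
    and nonpos: "\<And>t. 0 \<le> t \<Longrightarrow> \<phi>' t \<le> 0" and below: "\<And>t. 0 \<le> t \<Longrightarrow> b \<le> \<phi> t"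
  obtains L where "(\<phi> \<longlongrightarrow> L) at_top" "\<And>t. 0 \<le> t \<Longrightarrow> L \<le> \<phi> t"
proof -
  have bdd: "bdd_below (\<phi> ` {0..})" using below by (intro bdd_belowI[of _ b]) auto
  define L where "L = (INF t\<in>{0..}. \<phi> t)"
  have le: "L \<le> \<phi> t" if "0 \<le> t" for t
    unfolding L_def using that bdd by (intro cINF_lower) auto
  have "(\<phi> \<longlongrightarrow> L) at_top"
  proof (rule order_tendstoI)
    fix c assume "c < L"
    then show "\<forall>\<^sub>F t in at_top. c < \<phi> t"
      using le by (intro eventually_at_top_linorderI[of 0]) (meson less_le_trans)
  next
    fix c assume "L < c"
    then obtain s where s: "0 \<le> s" "\<phi> s < c"
      unfolding L_def using bdd by (subst (asm) cINF_less_iff) auto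
    then show "\<forall>\<^sub>F t in at_top. \<phi> t < c"
      using deriv_nonpos_imp_antimono[OF deriv nonpos, of 0 s]
      by (intro eventually_at_top_linorderI[of s]) force
  qed
  with le that show thesis by blast
qed

text \<open>Both contradictions in the asymptotic analysis have this form: a Lyapunov function that
  is bounded below cannot decrease at a fixed positive rate.\<close>

lemma deriv_bounded_away_not_bounded_below:
  fixes \<phi> :: "real \<Rightarrow> real"
  assumes deriv: "\<And>t. 0 \<le> t \<Longrightarrow> (\<phi> has_real_derivative \<phi>' t) (at t within {0..})"
    and neg: "\<And>t. T \<le> t \<Longrightarrow> \<phi>' t \<le> - c" and "0 < c" "0 \<le> T"
    and below: "\<And>t. 0 \<le> t \<Longrightarrow> b \<le> \<phi> t"
  shows False
proof -
  have "\<phi> t + c * t \<le> \<phi> T + c * T" if "T \<le> t" for t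
  proof (rule deriv_nonpos_imp_antimono[where \<phi> = "\<lambda>t. \<phi> t + c * t" and \<phi>' = "\<lambda>t. \<phi>' t + c"])
    show "((\<lambda>t. \<phi> t + c * t) has_real_derivative \<phi>' t + c) (at t within {0..})" if "0 \<le> t" for t
      using deriv[OF that] by (auto intro!: derivative_eq_intros)
  qed (use neg assms that in force)+
  moreover define e where "e = (\<phi> T - b + 1) / c"
  moreover have "0 \<le> e" "c * e = \<phi> T - b + 1"
    using below[of T] assms by (simp_all add: e_def)
  ultimately have "\<phi> (T + e) + c * T + (\<phi> T - b + 1) \<le> \<phi> T + c * T"
    by (metis add.assoc distrib_left le_add_same_cancel1)
  then show False using below[of "T + e"] \<open>0 \<le> e\<close> \<open>0 \<le> T\<close> by simp
qed

section \<open>Energy decay along a bounded trajectory\<close>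

text \<open>The gradients enter as a parameter \<open>g\<close>, so that their existence, a matter of the Riesz theorem,
  is kept apart from the dynamics.\<close>

locale bounded_inertial_trajectory =
  fixes m :: nat and f :: "nat \<Rightarrow> 'a::{real_inner, complete_space} \<Rightarrow> real"
    and g :: "nat \<Rightarrow> 'a \<Rightarrow> 'a" and \<alpha> :: real and x x' x'' :: "real \<Rightarrow> 'a"
  assumes m: "1 \<le> m" and \<alpha>: "0 < \<alpha>"
    and convex: "i \<in> {1..m} \<Longrightarrow> convex_on UNIV (f i)"
    and gderiv: "i \<in> {1..m} \<Longrightarrow> GDERIV (f i) y :> g i y"
    and x': "0 \<le> t \<Longrightarrow> (x has_vector_derivative x' t) (at t within {0..})"
    and x'': "0 \<le> t \<Longrightarrow> (x' has_vector_derivative x'' t) (at t within {0..})"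
    and equation: "0 \<le> t \<Longrightarrow>
      x'' t + \<alpha> *\<^sub>R x' t + proj (convex hull ((\<lambda>i. g i (x t)) ` {1..m})) (- x'' t) = 0"
    and bounded_x: "bounded (x ` {0..})"
    and bounded_g: "i \<in> {1..m} \<Longrightarrow> bounded (g i ` x ` {0..})"
begin

text \<open>The equation expresses that \<open>p t\<close> is the projection of \<open>- x'' t\<close> onto the hull of
  the gradients.\<close>

definition p :: "real \<Rightarrow> 'a" where "p t = - (x'' t + \<alpha> *\<^sub>R x' t)"

text \<open>The energy of the \<open>i\<close>-th objective: potential plus kinetic.\<close>

definition W :: "nat \<Rightarrow> real \<Rightarrow> real" where "W i t = f i (x t) + (norm (x' t))\<^sup>2 / 2"

text \<open>Here \<open>- x'' - p = \<alpha> x'\<close>, so the variational inequality of the projection compares the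
  components of \<open>p\<close> and of the gradients along the velocity.\<close>

lemma p_in_hull: "0 \<le> t \<Longrightarrow> p t \<in> convex hull ((\<lambda>i. g i (x t)) ` {1..m})"
  and gradient_inner_velocity_le: "0 \<le> t \<Longrightarrow> i \<in> {1..m} \<Longrightarrow> inner (x' t) (g i (x t)) \<le> inner (x' t) (p t)"
proof -
  assume t: "0 \<le> t"
  let ?S = "(\<lambda>i. g i (x t)) ` {1..m}"
  have S: "finite ?S" "?S \<noteq> {}" using m by auto
  have p: "p t = proj (convex hull ?S) (- x'' t)"
    using equation[OF t] by (simp add: p_def add_eq_0_iff)
  show "p t \<in> convex hull ?S" using proj_finite_hull(1)[OF S] p by simp
  assume i: "i \<in> {1..m}"
  then have "g i (x t) \<in> convex hull ?S" by (simp add: hull_inc)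
  then have "inner (- x'' t - p t) (g i (x t) - p t) \<le> 0"
    using proj_finite_hull(2)[OF S] p by simp
  then have "\<alpha> * inner (x' t) (g i (x t) - p t) \<le> 0" by (simp add: p_def)
  then show "inner (x' t) (g i (x t)) \<le> inner (x' t) (p t)"
    using \<alpha> by (simp add: mult_le_0_iff inner_diff_right)
qed

lemma f_deriv:
  assumes "0 \<le> t" "i \<in> {1..m}"
  shows "((\<lambda>t. f i (x t)) has_real_derivative inner (x' t) (g i (x t))) (at t within {0..})"
proof -
  have "((\<lambda>t. f i (x t)) has_derivative (\<lambda>s. inner (s *\<^sub>R x' t) (g i (x t)))) (at t within {0..})"
    using x'[OF assms(1)] gderiv[OF assms(2)] unfolding has_vector_derivative_def gderiv_def
    by (rule has_derivative_compose)
  then show ?thesis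
    unfolding has_field_derivative_def by (rule has_derivative_eq_rhs) (simp add: fun_eq_iff)
qed

lemma speed_sq_deriv:
  assumes "0 \<le> t"
  shows "((\<lambda>t. (norm (x' t))\<^sup>2) has_real_derivative 2 * inner (x' t) (x'' t)) (at t within {0..})"
  using has_real_derivative_inner[OF x'' x'', OF assms assms]
  by (simp add: power2_norm_eq_inner inner_commute)

definition W' :: "nat \<Rightarrow> real \<Rightarrow> real" where
  "W' i t = inner (x' t) (g i (x t)) + inner (x' t) (x'' t)"

lemma W_deriv:
  assumes "0 \<le> t" "i \<in> {1..m}"
  shows "(W i has_real_derivative W' i t) (at t within {0..})"
  unfolding W_def[abs_def] W'_def
  using DERIV_add[OF f_deriv[OF assms] DERIV_cdivide[OF speed_sq_deriv[OF assms(1)], of 2]] by simp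

lemma W'_le:
  assumes "0 \<le> t" "i \<in> {1..m}"
  shows "W' i t \<le> - \<alpha> * (norm (x' t))\<^sup>2"
proof -
  have "W' i t \<le> inner (x' t) (p t) + inner (x' t) (x'' t)"
    using gradient_inner_velocity_le[OF assms] by (simp add: W'_def)
  also have "\<dots> = - \<alpha> * (norm (x' t))\<^sup>2"
    by (simp add: p_def inner_add_right inner_diff_right power2_norm_eq_inner)
  finally show ?thesis .
qed

lemma W'_nonpos: "0 \<le> t \<Longrightarrow> i \<in> {1..m} \<Longrightarrow> W' i t \<le> 0"
  using W'_le[of t i] \<alpha> by (smt (verit) mult_nonneg_nonneg mult_minus_left zero_le_power2)

lemma f_bounded_below:
  assumes "i \<in> {1..m}"
  obtains b where "\<And>t. 0 \<le> t \<Longrightarrow> b \<le> f i (x t)"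
proof -
  obtain B where B: "\<And>t. 0 \<le> t \<Longrightarrow> norm (x t) \<le> B" using bounded_x by (auto simp: bounded_iff)
  have "f i 0 - norm (g i 0) * B \<le> f i (x t)" if "0 \<le> t" for t
  proof -
    have "f i 0 + inner (g i 0) (x t - 0) \<le> f i (x t)"
      by (rule convex_on_ge_tangent[OF convex gderiv]) (use assms in auto)
    moreover have "\<bar>inner (g i 0) (x t)\<bar> \<le> norm (g i 0) * norm (x t)"
      by (rule Cauchy_Schwarz_ineq2)
    moreover have "norm (g i 0) * norm (x t) \<le> norm (g i 0) * B"
      using B[OF that] by (intro mult_left_mono) auto
    ultimately show ?thesis by simp
  qed
  then show thesis by (rule that)
qed

lemma W_bounded_below:
  assumes "i \<in> {1..m}"
  obtains b where "\<And>t. 0 \<le> t \<Longrightarrow> b \<le> W i t"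
proof -
  obtain b where "\<And>t. 0 \<le> t \<Longrightarrow> b \<le> f i (x t)" using f_bounded_below[OF assms] by blast
  then have "\<And>t. 0 \<le> t \<Longrightarrow> b \<le> W i t" by (simp add: W_def add_increasing2)
  then show thesis by (rule that)
qed

lemma one_in: "1 \<in> {1..m}" using m by simp

text \<open>The equation determines \<open>x''\<close> only implicitly, since \<open>x''\<close> also occurs inside the
  projection. A bound on \<open>p\<close>, which holds because \<open>p\<close> lies in the hull of bounded gradients, still
  gives one on \<open>x'' = - p - \<alpha> x'\<close>.\<close>

lemma p_bounded:
  obtains M where "\<And>t. 0 \<le> t \<Longrightarrow> norm (p t) \<le> M"
proof -
  have "bounded (\<Union>i\<in>{1..m}. g i ` x ` {0..})" using bounded_g by (intro bounded_UN) auto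
  then obtain M where "\<forall>q\<in>(\<Union>i\<in>{1..m}. g i ` x ` {0..}). norm q \<le> M"
    by (auto simp only: bounded_iff)
  then have M: "norm (g i (x t)) \<le> M" if "0 \<le> t" "i \<in> {1..m}" for t i
    using that by auto
  have "convex hull ((\<lambda>i. g i (x t)) ` {1..m}) \<subseteq> cball 0 M" if "0 \<le> t" for t
    using M[OF that] by (intro hull_minimal) auto
  with p_in_hull have "\<And>t. 0 \<le> t \<Longrightarrow> norm (p t) \<le> M" by fastforce
  then show thesis by (rule that)
qed

lemma velocity_bounded:
  obtains B where "0 \<le> B" "\<And>t. 0 \<le> t \<Longrightarrow> norm (x' t) \<le> B"
proof -
  obtain b where b: "\<And>t. 0 \<le> t \<Longrightarrow> b \<le> f 1 (x t)" using f_bounded_below[OF one_in] by blast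
  have "norm (x' t) \<le> sqrt (2 * (W 1 0 - b))" if "0 \<le> t" for t
  proof (rule real_le_rsqrt)
    have "W 1 t \<le> W 1 0"
      by (rule deriv_nonpos_imp_antimono[OF W_deriv W'_nonpos, of _ 0 0 t]) (use one_in that in auto)
    then show "(norm (x' t))\<^sup>2 \<le> 2 * (W 1 0 - b)"
      using b[OF that] by (simp add: W_def)
  qed
  then have *: "\<And>t. 0 \<le> t \<Longrightarrow> norm (x' t) \<le> sqrt (2 * (W 1 0 - b))" .
  then have "0 \<le> sqrt (2 * (W 1 0 - b))" using norm_ge_zero order_trans order_refl by blast
  with * that show thesis by blast
qed

lemma acceleration_bounded:
  obtains M where "0 \<le> M" "\<And>t. 0 \<le> t \<Longrightarrow> norm (x'' t) \<le> M"
proof -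
  obtain B where B: "0 \<le> B" "\<And>t. 0 \<le> t \<Longrightarrow> norm (x' t) \<le> B" using velocity_bounded by blast
  obtain M where M: "\<And>t. 0 \<le> t \<Longrightarrow> norm (p t) \<le> M" using p_bounded by blast
  have *: "norm (x'' t) \<le> M + \<alpha> * B" if "0 \<le> t" for t
  proof -
    have "x'' t = - p t - \<alpha> *\<^sub>R x' t" by (simp add: p_def)
    then have "norm (x'' t) \<le> norm (p t) + \<alpha> * norm (x' t)"
      using norm_triangle_ineq4[of "- p t" "\<alpha> *\<^sub>R x' t"] \<alpha> by simp
    also have "\<dots> \<le> M + \<alpha> * B" using M[OF that] B(2)[OF that] \<alpha> by (intro add_mono mult_left_mono) auto
    finally show ?thesis .
  qed
  then have "0 \<le> M + \<alpha> * B" using norm_ge_zero order_trans order_refl by blast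
  with * that show thesis by blast
qed

lemma W_tendsto:
  assumes "i \<in> {1..m}"
  obtains L where "(W i \<longlongrightarrow> L) at_top" "\<And>t. 0 \<le> t \<Longrightarrow> L \<le> W i t"
proof -
  obtain b where b: "\<And>t. 0 \<le> t \<Longrightarrow> b \<le> W i t" using W_bounded_below[OF assms] by blast
  show thesis
    by (rule deriv_nonpos_bounded_below_tendsto[OF W_deriv W'_nonpos b]) (use assms that in auto)
qed

text \<open>Let \<open>u = |x'|\<^sup>2\<close>. The energy falls at rate at least \<open>\<alpha> u\<close>, while \<open>(u\<^sup>2)'\<close> is bounded by a
  multiple \<open>K u\<close> of the same quantity because \<open>x'\<close> and \<open>x''\<close> are bounded. Hence both
  \<open>K/\<alpha> W + u\<^sup>2\<close> and \<open>K/\<alpha> W - u\<^sup>2\<close> are nonincreasing, so both converge and with them \<open>u\<close>. A positive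
  limit of \<open>u\<close> would drive the energy to \<open>- \<infinity>\<close>. The square of \<open>u\<close> is essential: \<open>u'\<close> itself is
  only of order \<open>\<surd>u\<close>.\<close>

lemma velocity_tendsto_0: "((\<lambda>t. norm (x' t)) \<longlongrightarrow> 0) at_top"
proof -
  define u where "u t = (norm (x' t))\<^sup>2" for t
  obtain B where B: "0 \<le> B" "\<And>t. 0 \<le> t \<Longrightarrow> norm (x' t) \<le> B" using velocity_bounded by blast
  obtain M where M: "0 \<le> M" "\<And>t. 0 \<le> t \<Longrightarrow> norm (x'' t) \<le> M" using acceleration_bounded by blast
  define K where "K = 4 * B * M"
  have K0: "0 \<le> K" using B(1) M(1) by (simp add: K_def)
  obtain b where b: "\<And>t. 0 \<le> t \<Longrightarrow> b \<le> W 1 t" using W_bounded_below[OF one_in] by blast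
  let ?u' = "\<lambda>t. 2 * u t * (2 * inner (x' t) (x'' t))"
  have u_deriv: "((\<lambda>t. (u t)\<^sup>2) has_real_derivative ?u' t) (at t within {0..})" if "0 \<le> t" for t
    unfolding u_def using DERIV_power[OF speed_sq_deriv[OF that], of 2] by (simp add: algebra_simps)
  have u'_le: "\<bar>?u' t\<bar> \<le> K * u t" if "0 \<le> t" for t
  proof -
    have "\<bar>inner (x' t) (x'' t)\<bar> \<le> norm (x' t) * norm (x'' t)" by (rule Cauchy_Schwarz_ineq2)
    also have "\<dots> \<le> B * M" using B M that by (intro mult_mono) auto
    finally have "\<bar>inner (x' t) (x'' t)\<bar> * (4 * u t) \<le> B * M * (4 * u t)"
      by (intro mult_right_mono) (auto simp: u_def)
    then show ?thesis by (simp add: K_def abs_mult u_def algebra_simps)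
  qed
  have KW: "K / \<alpha> * W' 1 t \<le> - K * u t" if "0 \<le> t" for t
  proof -
    have "K / \<alpha> * W' 1 t \<le> K / \<alpha> * (- \<alpha> * u t)"
      using W'_le[OF that one_in] K0 \<alpha> unfolding u_def by (intro mult_left_mono) auto
    then show ?thesis using \<alpha> by simp
  qed
  have Wb: "K / \<alpha> * b \<le> K / \<alpha> * W 1 t" if "0 \<le> t" for t
    using b[OF that] K0 \<alpha> by (intro mult_left_mono) auto
  have conv: "\<exists>L. ((\<lambda>t. K / \<alpha> * W 1 t + s * (u t)\<^sup>2) \<longlongrightarrow> L) at_top" if s: "s = 1 \<or> s = -1" for s
  proof (rule deriv_nonpos_bounded_below_tendsto)
    fix t :: real assume t: "0 \<le> t"
    show "((\<lambda>t. K / \<alpha> * W 1 t + s * (u t)\<^sup>2) has_real_derivative K / \<alpha> * W' 1 t + s * ?u' t)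
        (at t within {0..})"
      by (intro DERIV_add DERIV_cmult W_deriv u_deriv t one_in)
    show "K / \<alpha> * W' 1 t + s * ?u' t \<le> 0"
      using KW[OF t] u'_le[OF t] s by auto
    have "u t \<le> B\<^sup>2" unfolding u_def using B t by (intro power_mono) auto
    then have "(u t)\<^sup>2 \<le> (B\<^sup>2)\<^sup>2" by (intro power_mono) (auto simp: u_def)
    moreover have "0 \<le> (u t)\<^sup>2" by simp
    ultimately show "K / \<alpha> * b - (B\<^sup>2)\<^sup>2 \<le> K / \<alpha> * W 1 t + s * (u t)\<^sup>2"
      using Wb[OF t] s zero_le_power2[of "B\<^sup>2"] by (elim disjE; hypsubst; linarith)
  qed blast
  obtain L1 where L1: "((\<lambda>t. K / \<alpha> * W 1 t + (u t)\<^sup>2) \<longlongrightarrow> L1) at_top"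
    using conv[of 1] by auto
  obtain L2 where L2: "((\<lambda>t. K / \<alpha> * W 1 t - (u t)\<^sup>2) \<longlongrightarrow> L2) at_top"
    using conv[of "-1"] by auto
  define L where "L = (L1 - L2) / 2"
  have "((\<lambda>t. ((K / \<alpha> * W 1 t + (u t)\<^sup>2) - (K / \<alpha> * W 1 t - (u t)\<^sup>2)) / 2) \<longlongrightarrow> L) at_top"
    unfolding L_def by (intro tendsto_intros L1 L2) auto
  then have "((\<lambda>t. (u t)\<^sup>2) \<longlongrightarrow> L) at_top" by (simp add: field_simps)
  moreover have "sqrt ((u t)\<^sup>2) = u t" for t by (simp only: real_sqrt_abs) (simp add: u_def)
  ultimately have uL: "(u \<longlongrightarrow> sqrt L) at_top"
    using tendsto_real_sqrt[of "\<lambda>t. (u t)\<^sup>2" L at_top] by simp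
  have "\<not> 0 < sqrt L"
  proof
    assume pos: "0 < sqrt L"
    then have "\<forall>\<^sub>F t in at_top. sqrt L / 2 < u t" by (intro order_tendstoD(1)[OF uL]) simp
    then obtain T where T: "\<And>t. T \<le> t \<Longrightarrow> sqrt L / 2 < u t"
      by (auto simp: eventually_at_top_linorder)
    show False
    proof (rule deriv_bounded_away_not_bounded_below[OF W_deriv _ _ _ b])
      fix t assume t: "max 0 T \<le> t"
      then have "W' 1 t \<le> - \<alpha> * u t" using W'_le[OF _ one_in, of t] by (simp add: u_def)
      also have "\<dots> \<le> - \<alpha> * (sqrt L / 2)" using T[of t] t \<alpha> by simp
      finally show "W' 1 t \<le> - (\<alpha> * (sqrt L / 2))" by simp
    qed (use pos \<alpha> one_in in auto)
  qed
  moreover have "0 \<le> sqrt L"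
    by (rule tendsto_lowerbound[OF uL]) (auto simp: u_def)
  ultimately have "(u \<longlongrightarrow> 0) at_top" using uL by simp
  from tendsto_real_sqrt[OF this] show ?thesis by (simp add: u_def)
qed

definition F :: "nat \<Rightarrow> real" where "F i = Lim at_top (\<lambda>t. f i (x t))"

lemma
  assumes "i \<in> {1..m}"
  shows f_tendsto_F: "((\<lambda>t. f i (x t)) \<longlongrightarrow> F i) at_top"
    and F_le_W: "0 \<le> t \<Longrightarrow> F i \<le> W i t"
proof -
  obtain L where L: "(W i \<longlongrightarrow> L) at_top" "\<And>t. 0 \<le> t \<Longrightarrow> L \<le> W i t"
    using W_tendsto[OF assms] by blast
  have "((\<lambda>t. W i t - (norm (x' t))\<^sup>2 / 2) \<longlongrightarrow> L - 0\<^sup>2 / 2) at_top"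
    by (intro tendsto_intros L velocity_tendsto_0) auto
  then have "((\<lambda>t. f i (x t)) \<longlongrightarrow> L) at_top" by (simp add: W_def)
  moreover from this have "F i = L" unfolding F_def by (intro tendsto_Lim) auto
  ultimately show "((\<lambda>t. f i (x t)) \<longlongrightarrow> F i) at_top" "0 \<le> t \<Longrightarrow> F i \<le> W i t"
    using L by auto
qed

section \<open>Distance to points below the limits\<close>

text \<open>With \<open>h = |x - z|\<^sup>2 / 2\<close> the first two terms are \<open>h' + \<alpha> h\<close>, whose derivative is
  \<open>|x'|\<^sup>2 - \<langle>x - z, p\<rangle>\<close>. For \<open>z\<close> below the limits \<open>F i\<close> the inner product can only be bounded
  below by \<open>- |x'|\<^sup>2 / 2\<close>, so an excess of \<open>3/2 |x'|\<^sup>2\<close> must be absorbed; the factor of the energy is chosen for that.\<close>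

definition G :: "'a \<Rightarrow> real \<Rightarrow> real" where
  "G z t = inner (x t - z) (x' t) + \<alpha> / 2 * (norm (x t - z))\<^sup>2 + 3 / (2 * \<alpha>) * W 1 t"

definition G' :: "'a \<Rightarrow> real \<Rightarrow> real" where
  "G' z t = (norm (x' t))\<^sup>2 - inner (x t - z) (p t) + 3 / (2 * \<alpha>) * W' 1 t"

lemma G_deriv:
  assumes "0 \<le> t"
  shows "(G z has_real_derivative G' z t) (at t within {0..})"
proof -
  have d: "((\<lambda>t. x t - z) has_vector_derivative x' t) (at t within {0..})"
    using has_vector_derivative_diff[OF x'[OF assms] has_vector_derivative_const, of z] by simp
  have "(G z has_real_derivative
      (inner (x t - z) (x'' t) + inner (x' t) (x' t))
      + \<alpha> / 2 * (inner (x t - z) (x' t) + inner (x' t) (x t - z)) + 3 / (2 * \<alpha>) * W' 1 t)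
      (at t within {0..})"
    unfolding G_def[abs_def] power2_norm_eq_inner
    by (intro DERIV_add DERIV_cmult has_real_derivative_inner d x'' W_deriv assms one_in)
  then show ?thesis
    by (rule DERIV_cong) (simp add: G'_def p_def power2_norm_eq_inner inner_commute algebra_simps)
qed

text \<open>By convexity \<open>\<langle>x - z, \<nabla>f i (x)\<rangle> \<ge> f i (x) - f i z\<close>, and \<open>f i (x) \<ge> F i - |x'|\<^sup>2 / 2\<close> because
  the energy decreases to its limit \<open>F i\<close>. The resulting lower bound is the same for all \<open>i\<close>, so it
  describes a half-space containing every gradient, and therefore also \<open>p\<close>.\<close>

lemma G'_le:
  assumes t: "0 \<le> t" and z: "\<And>i. i \<in> {1..m} \<Longrightarrow> f i z + \<delta> \<le> F i"
  shows "G' z t \<le> - \<delta>"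
proof -
  define c where "c = \<delta> - (norm (x' t))\<^sup>2 / 2"
  have "c \<le> inner (x t - z) (g i (x t))" if i: "i \<in> {1..m}" for i
  proof -
    have "f i (x t) + inner (g i (x t)) (z - x t) \<le> f i z"
      by (rule convex_on_ge_tangent[OF convex gderiv]) fact+
    moreover have "f i z + \<delta> \<le> f i (x t) + (norm (x' t))\<^sup>2 / 2"
      using F_le_W[OF i t] z[OF i] by (simp add: W_def)
    ultimately show ?thesis by (simp add: c_def inner_diff_left inner_diff_right inner_commute)
  qed
  then have "convex hull ((\<lambda>i. g i (x t)) ` {1..m}) \<subseteq> {q. c \<le> inner (x t - z) q}"
    using convex_halfspace_ge by (intro hull_minimal) auto
  with p_in_hull[OF t] have "c \<le> inner (x t - z) (p t)" by auto
  moreover have "3 / (2 * \<alpha>) * W' 1 t \<le> 3 / (2 * \<alpha>) * (- \<alpha> * (norm (x' t))\<^sup>2)"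
    using W'_le[OF t one_in] \<alpha> by (intro mult_left_mono) auto
  ultimately show ?thesis using \<alpha> by (simp add: G'_def c_def)
qed

lemma position_inner_velocity_tendsto_0: "((\<lambda>t. inner (x t - z) (x' t)) \<longlongrightarrow> 0) at_top"
proof -
  obtain B where B: "\<And>t. 0 \<le> t \<Longrightarrow> norm (x t) \<le> B" using bounded_x by (auto simp: bounded_iff)
  have "((\<lambda>t. (B + norm z) * norm (x' t)) \<longlongrightarrow> (B + norm z) * 0) at_top"
    by (intro tendsto_intros velocity_tendsto_0)
  moreover have "\<forall>\<^sub>F t in at_top. norm (inner (x t - z) (x' t)) \<le> (B + norm z) * norm (x' t)"
  proof (rule eventually_at_top_linorderI[of 0])
    fix t :: real assume "0 \<le> t"
    have "norm (inner (x t - z) (x' t)) \<le> norm (x t - z) * norm (x' t)"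
      by (simp add: Cauchy_Schwarz_ineq2)
    also have "\<dots> \<le> (B + norm z) * norm (x' t)"
      using B[OF \<open>0 \<le> t\<close>] norm_triangle_ineq4[of "x t" z] by (intro mult_right_mono) auto
    finally show "norm (inner (x t - z) (x' t)) \<le> (B + norm z) * norm (x' t)" .
  qed
  ultimately show ?thesis by (simp add: Lim_null_comparison)
qed

lemma G_bounded_below:
  obtains b where "\<And>t. 0 \<le> t \<Longrightarrow> b \<le> G z t"
proof -
  obtain B where B: "\<And>t. 0 \<le> t \<Longrightarrow> norm (x t) \<le> B" using bounded_x by (auto simp: bounded_iff)
  obtain V where V: "0 \<le> V" "\<And>t. 0 \<le> t \<Longrightarrow> norm (x' t) \<le> V" using velocity_bounded by blast
  obtain b where b: "\<And>t. 0 \<le> t \<Longrightarrow> b \<le> W 1 t" using W_bounded_below[OF one_in] by blast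
  have "- ((B + norm z) * V) + 3 / (2 * \<alpha>) * b \<le> G z t" if t: "0 \<le> t" for t
  proof -
    have "\<bar>inner (x t - z) (x' t)\<bar> \<le> norm (x t - z) * norm (x' t)"
      by (rule Cauchy_Schwarz_ineq2)
    also have "\<dots> \<le> (B + norm z) * V"
      using B[OF t] V t norm_triangle_ineq4[of "x t" z] order_trans[OF norm_ge_zero B[OF t]]
      by (intro mult_mono) auto
    finally have "- ((B + norm z) * V) \<le> inner (x t - z) (x' t)" by simp
    moreover have "0 \<le> \<alpha> / 2 * (norm (x t - z))\<^sup>2" using \<alpha> by simp
    moreover have "3 / (2 * \<alpha>) * b \<le> 3 / (2 * \<alpha>) * W 1 t"
      using b[OF t] \<alpha> by (intro mult_left_mono) auto
    ultimately show ?thesis by (simp add: G_def)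
  qed
  then show thesis by (rule that)
qed

text \<open>Otherwise \<open>G z\<close> would decrease at a positive rate, although it is bounded below.\<close>

lemma not_uniformly_below_limits: "\<exists>i\<in>{1..m}. F i \<le> f i z"
proof (rule ccontr)
  assume "\<not> ?thesis"
  then have less: "\<And>i. i \<in> {1..m} \<Longrightarrow> f i z < F i" by force
  \<comment> \<open>The minimum is positive because there are only finitely many objectives.\<close>
  define \<delta> where "\<delta> = Min ((\<lambda>i. F i - f i z) ` {1..m})"
  have "0 < \<delta>" unfolding \<delta>_def using less m by (subst Min_gr_iff) auto
  have \<delta>: "f i z + \<delta> \<le> F i" if "i \<in> {1..m}" for i
  proof -
    have "\<delta> \<le> F i - f i z" unfolding \<delta>_def using that by (intro Min_le) auto
    then show ?thesis by simp
  qed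
  obtain b where b: "\<And>t. 0 \<le> t \<Longrightarrow> b \<le> G z t" using G_bounded_below by blast
  show False
    by (rule deriv_bounded_away_not_bounded_below[OF G_deriv G'_le[OF _ \<delta>] \<open>0 < \<delta>\<close> order_refl b])
qed

text \<open>\<open>G z\<close> is nonincreasing, and all its terms other than the squared distance are known to converge.\<close>

lemma distance_tendsto:
  assumes z: "\<And>i. i \<in> {1..m} \<Longrightarrow> f i z \<le> F i"
  shows "\<exists>L. ((\<lambda>t. (norm (x t - z))\<^sup>2) \<longlongrightarrow> L) at_top"
proof -
  obtain b where b: "\<And>t. 0 \<le> t \<Longrightarrow> b \<le> G z t" using G_bounded_below by blast
  have G'0: "G' z t \<le> 0" if "0 \<le> t" for t using G'_le[OF that, of z 0] z by simp
  obtain L where L: "(G z \<longlongrightarrow> L) at_top"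
    using deriv_nonpos_bounded_below_tendsto[OF G_deriv G'0 b] by blast
  obtain L1 where L1: "(W 1 \<longlongrightarrow> L1) at_top" using W_tendsto[OF one_in] by blast
  have "((\<lambda>t. 2 / \<alpha> * (G z t - inner (x t - z) (x' t) - 3 / (2 * \<alpha>) * W 1 t))
      \<longlongrightarrow> 2 / \<alpha> * (L - 0 - 3 / (2 * \<alpha>) * L1)) at_top"
    by (intro tendsto_intros L L1 position_inner_velocity_tendsto_0)
  moreover have "2 / \<alpha> * (G z t - inner (x t - z) (x' t) - 3 / (2 * \<alpha>) * W 1 t) = (norm (x t - z))\<^sup>2" for t
    using \<alpha> by (simp add: G_def)
  ultimately show ?thesis by auto
qed

section \<open>Weak convergence by Opial's argument\<close>

text \<open>For \<open>A\<close> unbounded above, the points \<open>w\<close> play the part of weak cluster points of \<open>x\<close> as \<open>t\<close> grows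
  within \<open>A\<close>. Tails are replaced by their closed convex hulls because these form a nested family with
  nonempty intersection, and because membership of a tail in a closed convex set is all that has to be
  transferred to \<open>w\<close>.\<close>

definition cluster :: "real set \<Rightarrow> 'a \<Rightarrow> bool" where
  "cluster A w \<longleftrightarrow> (\<forall>T\<ge>0. w \<in> closure (convex hull (x ` (A \<inter> {T..}))))"

lemma cluster_exists:
  assumes "\<And>T. A \<inter> {T..} \<noteq> {}"
  obtains w where "cluster A w"
proof -
  define C where "C n = closure (convex hull (x ` (A \<inter> {real n..})))" for n
  have mono: "closure (convex hull (x ` (A \<inter> {s..}))) \<subseteq> closure (convex hull (x ` (A \<inter> {t..})))"
    if "t \<le> s" for s t
    using that by (intro closure_mono hull_mono) auto
  obtain w where w: "\<And>n. w \<in> C n"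
  proof (rule decreasing_closed_convex_nest[of C])
    show "C n \<noteq> {}" for n using assms[of n] unfolding C_def closure_eq_empty convex_hull_eq_empty by simp
    show "bounded (C 0)"
      unfolding C_def by (intro bounded_closure bounded_convex_hull bounded_subset[OF bounded_x]) auto
    show "C n \<subseteq> C m" if "m \<le> n" for m n
      unfolding C_def using that by (intro mono) simp
    show "closed (C n)" "convex (C n)" for n
      by (simp_all add: C_def convex_closure)
  qed (rule that)
  have "cluster A w"
    unfolding cluster_def
  proof (intro allI impI)
    fix T :: real
    obtain n where "T \<le> real n" using real_arch_simple by blast
    then show "w \<in> closure (convex hull (x ` (A \<inter> {T..})))"
      using mono w[of n] unfolding C_def by blast
  qed
  then show thesis by (rule that)
qed

lemma cluster_in_closed_convex:
  assumes "cluster A w" "closed K" "convex K" "\<forall>\<^sub>F t in at_top. t \<in> A \<longrightarrow> x t \<in> K"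
  shows "w \<in> K"
proof -
  obtain T where T: "\<And>t. T \<le> t \<Longrightarrow> t \<in> A \<Longrightarrow> x t \<in> K"
    using assms(4) by (auto simp: eventually_at_top_linorder)
  then have "closure (convex hull (x ` (A \<inter> {max 0 T..}))) \<subseteq> K"
    using assms(2,3) by (intro closure_minimal hull_minimal) auto
  then show ?thesis using assms(1) unfolding cluster_def by (meson max.cobounded1 subsetD)
qed

text \<open>Sublevel sets of the continuous convex function \<open>f i\<close> are closed and convex.\<close>

lemma cluster_below_limits:
  assumes "cluster A w" "i \<in> {1..m}"
  shows "f i w \<le> F i"
proof (rule field_le_epsilon)
  fix e :: real assume "0 < e"
  have cont: "continuous_on UNIV (f i)"
    using gderiv[OF assms(2)] unfolding gderiv_def
    by (intro continuous_at_imp_continuous_on) (auto intro: has_derivative_continuous)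
  have "w \<in> {y. f i y \<le> F i + e}"
  proof (rule cluster_in_closed_convex[OF assms(1)])
    show "closed {y. f i y \<le> F i + e}" by (intro closed_Collect_le cont continuous_intros)
    show "convex {y. f i y \<le> F i + e}"
    proof (rule convexI, unfold mem_Collect_eq)
      fix y z and u v :: real
      assume *: "f i y \<le> F i + e" "f i z \<le> F i + e" "0 \<le> u" "0 \<le> v" "u + v = 1"
      then have "f i (u *\<^sub>R y + v *\<^sub>R z) \<le> u * f i y + v * f i z"
        using convex[OF assms(2)] by (auto simp: convex_on_def)
      also have "\<dots> \<le> u * (F i + e) + v * (F i + e)"
        using * by (intro add_mono mult_left_mono) auto
      also have "\<dots> = F i + e" using * by (simp flip: distrib_right)
      finally show "f i (u *\<^sub>R y + v *\<^sub>R z) \<le> F i + e" .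
    qed
    have "\<forall>\<^sub>F t in at_top. f i (x t) < F i + e"
      using \<open>0 < e\<close> by (intro order_tendstoD(2)[OF f_tendsto_F[OF assms(2)]]) simp
    then show "\<forall>\<^sub>F t in at_top. t \<in> A \<longrightarrow> x t \<in> {y. f i y \<le> F i + e}"
      by (rule eventually_mono) auto
  qed
  then show "f i w \<le> F i + e" by simp
qed

lemma cluster_inner_eq:
  assumes "cluster A w" "((\<lambda>t. inner a (x t)) \<longlongrightarrow> c) at_top"
  shows "inner a w = c"
proof -
  have "w \<in> {y. inner a y \<le> c + e}" "w \<in> {y. c - e \<le> inner a y}" if "0 < e" for e
  proof -
    have "\<forall>\<^sub>F t in at_top. inner a (x t) < c + e" "\<forall>\<^sub>F t in at_top. c - e < inner a (x t)"
      using that by (auto intro: order_tendstoD[OF assms(2)])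
    then have "\<forall>\<^sub>F t in at_top. t \<in> A \<longrightarrow> x t \<in> {y. inner a y \<le> c + e}"
        "\<forall>\<^sub>F t in at_top. t \<in> A \<longrightarrow> x t \<in> {y. c - e \<le> inner a y}"
      by (auto elim: eventually_mono)
    then show "w \<in> {y. inner a y \<le> c + e}" "w \<in> {y. c - e \<le> inner a y}"
      using cluster_in_closed_convex[OF assms(1) closed_halfspace_le convex_halfspace_le]
        cluster_in_closed_convex[OF assms(1), where K = "{y. c - e \<le> inner a y}"]
        closed_halfspace_ge[of "c - e" a] convex_halfspace_ge[of "c - e" a]
      by auto
  qed
  then have "\<And>e. 0 < e \<Longrightarrow> inner a w \<le> c + e" "\<And>e. 0 < e \<Longrightarrow> c \<le> inner a w + e"
    by (force simp: algebra_simps)+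
  then show ?thesis by (meson antisym field_le_epsilon)
qed

text \<open>The difference \<open>|x - z|\<^sup>2 - |x - w|\<^sup>2\<close> is affine in \<open>x\<close> with linear part \<open>2 \<langle>w - z, x\<rangle>\<close>. As both
  distances converge, \<open>\<langle>w - z, x t\<rangle>\<close> has a limit, which must equal both \<open>\<langle>w - z, w\<rangle>\<close> and
  \<open>\<langle>w - z, z\<rangle>\<close>.\<close>

lemma cluster_unique:
  assumes "cluster A w" "cluster B z"
  shows "w = z"
proof -
  obtain L1 where L1: "((\<lambda>t. (norm (x t - w))\<^sup>2) \<longlongrightarrow> L1) at_top"
    using distance_tendsto cluster_below_limits[OF assms(1)] by blast
  obtain L2 where L2: "((\<lambda>t. (norm (x t - z))\<^sup>2) \<longlongrightarrow> L2) at_top"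
    using distance_tendsto cluster_below_limits[OF assms(2)] by blast
  define c where "c = (L2 - L1 + inner w w - inner z z) / 2"
  have "((\<lambda>t. ((norm (x t - z))\<^sup>2 - (norm (x t - w))\<^sup>2 + inner w w - inner z z) / 2) \<longlongrightarrow> c) at_top"
    unfolding c_def by (intro tendsto_intros L1 L2) auto
  moreover have "((norm (x t - z))\<^sup>2 - (norm (x t - w))\<^sup>2 + inner w w - inner z z) / 2
      = inner (w - z) (x t)" for t
    by (simp add: power2_norm_eq_inner inner_diff_left inner_diff_right inner_commute field_simps)
  ultimately have lim: "((\<lambda>t. inner (w - z) (x t)) \<longlongrightarrow> c) at_top" by simp
  have "inner (w - z) (w - z) = 0"
    using cluster_inner_eq[OF assms(1) lim] cluster_inner_eq[OF assms(2) lim]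
    by (simp add: inner_diff_right)
  then show ?thesis by simp
qed

text \<open>If \<open>\<psi> (x t) \<ge> \<psi> w + e\<close> at arbitrarily late times \<open>t\<close>, these times have a cluster point of
  their own. It lies in the closed half-space \<open>\<psi> \<ge> \<psi> w + e\<close>, so it differs from \<open>w\<close>, against
  uniqueness. Applied to \<open>\<phi>\<close> and \<open>- \<phi>\<close> this gives both bounds.\<close>

lemma weakly_converges_cluster:
  assumes "cluster UNIV w"
  shows "weakly_converges x w at_top"
  unfolding weakly_converges_def
proof (intro allI impI)
  fix \<phi> :: "'a \<Rightarrow> real" assume \<phi>: "bounded_linear \<phi>"
  have upper: "\<forall>\<^sub>F t in at_top. \<psi> (x t) < \<psi> w + e"
    if \<psi>: "bounded_linear \<psi>" and e: "0 < e" for \<psi> :: "'a \<Rightarrow> real" and e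
  proof (rule ccontr)
    interpret bounded_linear \<psi> by fact
    assume neg: "\<not> ?thesis"
    define A where "A = {t. \<psi> w + e \<le> \<psi> (x t)}"
    have "A \<inter> {T..} \<noteq> {}" for T
      using neg unfolding A_def eventually_at_top_linorder by (force simp: not_less)
    then obtain z where z: "cluster A z" using cluster_exists by blast
    have "z \<in> {y. \<psi> w + e \<le> \<psi> y}"
    proof (rule cluster_in_closed_convex[OF z])
      show "closed {y. \<psi> w + e \<le> \<psi> y}"
        by (intro closed_Collect_le continuous_intros linear_continuous_on \<psi>)
      have "{y. \<psi> w + e \<le> \<psi> y} = \<psi> -` {\<psi> w + e..}" by auto
      then show "convex {y. \<psi> w + e \<le> \<psi> y}"
        using convex_linear_vimage[OF linear_axioms, of "{\<psi> w + e..}"] by simp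
    qed (simp add: A_def)
    then show False using cluster_unique[OF z assms] e by simp
  qed
  show "((\<lambda>t. \<phi> (x t)) \<longlongrightarrow> \<phi> w) at_top"
  proof (rule order_tendstoI)
    fix c assume "\<phi> w < c"
    then show "\<forall>\<^sub>F t in at_top. \<phi> (x t) < c" using upper[OF \<phi>, of "c - \<phi> w"] by simp
  next
    fix c assume "c < \<phi> w"
    then show "\<forall>\<^sub>F t in at_top. c < \<phi> (x t)"
      using upper[OF bounded_linear_minus[OF \<phi>], of "\<phi> w - c"] by simp
  qed
qed

section \<open>Criticality of the limit\<close>

text \<open>If \<open>0\<close> is not in the hull, its minimal-norm element \<open>q\<close> is nonzero and \<open>- q\<close> is a descent
  direction for every \<open>f i\<close>. A short step from \<open>w\<close> then reaches a point strictly below all \<open>F i\<close>.\<close>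

lemma zero_in_gradient_hull:
  assumes w: "\<And>i. i \<in> {1..m} \<Longrightarrow> f i w \<le> F i"
  shows "0 \<in> convex hull ((\<lambda>i. g i w) ` {1..m})"
proof (rule ccontr)
  let ?K = "convex hull ((\<lambda>i. g i w) ` {1..m})"
  assume no: "0 \<notin> ?K"
  define q where "q = proj ?K 0"
  have ne: "(\<lambda>i. g i w) ` {1..m} \<noteq> {}" using m by auto
  have "q \<in> ?K" unfolding q_def by (rule proj_finite_hull(1)) (use ne in auto)
  with no have "q \<noteq> 0" by auto
  have desc: "inner (g i w) (- q) < 0" if "i \<in> {1..m}" for i
  proof -
    have "g i w \<in> ?K" using that by (simp add: hull_inc)
    then have "inner (0 - q) (g i w - q) \<le> 0"
      unfolding q_def by (intro proj_finite_hull(2)) (use ne in auto)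
    then have "inner q q \<le> inner (g i w) q" by (simp add: inner_diff_right inner_commute)
    moreover have "0 < inner q q" using \<open>q \<noteq> 0\<close> by simp
    ultimately show ?thesis by (simp only: inner_minus_right)
  qed
  have "\<forall>\<^sub>F s in at_right 0. f i (w + s *\<^sub>R (- q)) < F i" if i: "i \<in> {1..m}" for i
  proof -
    have "\<forall>\<^sub>F s in at_right 0. (f i (w + s *\<^sub>R (- q)) - f i w) / s < 0"
      by (rule order_tendstoD(2)[OF gderiv_tendsto_slope[OF gderiv[OF i]] desc[OF i]])
    then show ?thesis
      using eventually_at_right_less[of "0::real"]
    proof eventually_elim
      case (elim s)
      then have "f i (w + s *\<^sub>R (- q)) < f i w" by (simp add: divide_less_0_iff)
      then show ?case using w[OF i] by simp
    qed
  qed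
  then have "\<forall>\<^sub>F s in at_right 0. \<forall>i\<in>{1..m}. f i (w + s *\<^sub>R (- q)) < F i"
    by (intro eventually_ball_finite) auto
  then obtain s where "\<forall>i\<in>{1..m}. f i (w + s *\<^sub>R (- q)) < F i"
    using eventually_happens'[of "at_right (0::real)"] trivial_limit_at_right_real by blast
  with not_uniformly_below_limits[of "w + s *\<^sub>R (- q)"] show False by force
qed

lemma weak_limit_exists:
  obtains w where "0 \<in> convex hull ((\<lambda>i. g i w) ` {1..m})" "weakly_converges x w at_top"
proof -
  obtain w where w: "cluster UNIV w" using cluster_exists[of UNIV] by auto
  show thesis
    using that zero_in_gradient_hull weakly_converges_cluster[OF w] cluster_below_limits[OF w] by blast
qed

end

theorem theorem4p7:
  fixes f :: "nat \<Rightarrow> 'a::{real_inner, complete_space} \<Rightarrow> real"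
    and m :: nat and \<alpha> :: real and x0 v0 :: 'a and x :: "real \<Rightarrow> 'a"
  assumes "1 \<le> m"
    and "0 < \<alpha>"
    and "\<And>i. i \<in> {1..m} \<Longrightarrow> convex_on UNIV (f i)"
    and "\<And>i y. i \<in> {1..m} \<Longrightarrow> f i differentiable (at y)"
    and "\<And>i B. i \<in> {1..m} \<Longrightarrow> bounded B \<Longrightarrow> \<exists>L. L-lipschitz_on B (gradient (f i))"
    and "cauchy_solution m f \<alpha> x0 v0 x"
    and "bounded (x ` {0..})"
  shows "\<exists>x_star. pareto_critical m f x_star \<and> weakly_converges x x_star at_top"
proof -
  obtain x' x'' where sol:
    "\<And>t. 0 \<le> t \<Longrightarrow> (x has_vector_derivative x' t) (at t within {0..})"
    "\<And>t. 0 \<le> t \<Longrightarrow> (x' has_vector_derivative x'' t) (at t within {0..})"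
    "\<And>t. 0 \<le> t \<Longrightarrow> x'' t + \<alpha> *\<^sub>R x' t + proj (gradient_hull m f (x t)) (- x'' t) = 0"
    using assms(6) unfolding cauchy_solution_def by blast
  have hull: "gradient_hull m f y = convex hull ((\<lambda>i. gradient (f i) y) ` {1..m})" for y
    unfolding gradient_hull_def by (simp only: Setcompr_eq_image)
  have bounded: "bounded (gradient (f i) ` x ` {0..})" if "i \<in> {1..m}" for i
    using assms(5)[OF that assms(7)] lipschitz_on_bounded_image[OF _ assms(7)] by blast
  interpret bounded_inertial_trajectory m f "\<lambda>i. gradient (f i)" \<alpha> x x' x''
  proof unfold_locales
    show "GDERIV (f i) y :> gradient (f i) y" if "i \<in> {1..m}" for i y
      using that assms(4) by (intro gderiv_gradient)
  qed (fact assms(1-3,7) bounded sol(1,2) sol(3)[unfolded hull])+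
  obtain w where w: "0 \<in> convex hull ((\<lambda>i. gradient (f i) w) ` {1..m})"
    and conv: "weakly_converges x w at_top"
    using weak_limit_exists by blast
  obtain \<theta> :: "nat \<Rightarrow> real" where "\<And>i. i \<in> {1..m} \<Longrightarrow> 0 \<le> \<theta> i" "sum \<theta> {1..m} = 1"
    "(\<Sum>i\<in>{1..m}. \<theta> i *\<^sub>R gradient (f i) w) = 0"
    using convex_hull_image_weights[OF _ w] by auto
  then have "pareto_critical m f w" unfolding pareto_critical_def by blast
  with conv show ?thesis by blast
qed

end
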